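(* Let $\mathbb{V}$ be a finite dimensional vector space over a field $\mathbb{F}$. If $\dim(\mathbb{V})\geq 3$, then the subspace sum graph $\mathcal{G}(\mathbb{V})$ is connected and $\operatorname{diam}(\mathcal{G}(\mathbb{V}))=2$.
   Context: For a finite dimensional vector space $\mathbb{V}$ over a field $\mathbb{F}$ with $\dim(\mathbb{V})>1$, the subspace sum graph $\mathcal{G}(\mathbb{V})$ is the graph whose vertices are the non-trivial proper subspaces of $\mathbb{V}$ (subspaces $W$ with $W\neq\{0\}$ and $W\neq\mathbb{V}$), two vertices $W_1,W_2$ being adjacent if and only if $W_1+W_2=\mathbb{V}$. The graph may be infinite. The distance $d(u,v)$ is the length of a shortest path joining $u$ and $v$ ($\infty$ if there is none), and $\operatorname{diam}(G)=\max_{u,v} d(u,v)$ if it exists, and $\infty$ otherwise. *)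

theory Defs
  imports
    "Graph_Theory.Graph_Theory"
    "HOL-Library.Extended_Nat"
    "HOL-Library.Set_Algebras"
begin

text \<open>As in Graph_Theory, undirected graphs are symmetric digraphs, here with pairs of vertices
  as arcs.  The vertex set may be infinite.\<close>

text \<open>The infimum of the empty set in \<^typ>\<open>enat\<close> is \<open>\<infinity>\<close>, which is the distance of two vertices
  not joined by a path.\<close>

definition graph_dist :: "('a, 'b) pre_digraph \<Rightarrow> 'a \<Rightarrow> 'a \<Rightarrow> enat" where
  "graph_dist G u v = (INF p \<in> {p. pre_digraph.apath G u p v}. enat (length p))"

definition diameter :: "('a, 'b) pre_digraph \<Rightarrow> enat" where
  "diameter G =
    (let D = {graph_dist G u v | u v. u \<in> verts G \<and> v \<in> verts G}
     in if \<exists>m\<in>D. \<forall>d\<in>D. d \<le> m then (GREATEST m. m \<in> D) else \<infinity>)"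

text \<open>The space is the whole type, so \<^term>\<open>UNIV\<close> is its improper subspace; the sum of two
  subspaces is the elementwise sum of sets from Set_Algebras.\<close>

definition subspace_sum_graph ::
    "('a::field \<Rightarrow> 'b::ab_group_add \<Rightarrow> 'b) \<Rightarrow> ('b set, 'b set \<times> 'b set) pre_digraph" where
  "subspace_sum_graph scale =
    (let V = {W. module.subspace scale W \<and> W \<noteq> {0} \<and> W \<noteq> UNIV}
     in with_proj \<lparr> pverts = V, parcs = {(W1, W2). W1 \<in> V \<and> W2 \<in> V \<and> W1 + W2 = UNIV} \<rparr>)"

lemma subspace_plus_self:
  assumes "vector_space scale" and W: "module.subspace scale W"
  shows "W + W = W"
proof -
  interpret V: vector_space scale by fact
  have "x + y \<in> W" if "x \<in> W" "y \<in> W" for x y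
    using V.subspace_add[OF W] that by blast
  moreover have "x \<in> W + W" if "x \<in> W" for x
    using set_plus_intro[OF that V.subspace_0[OF W]] by simp
  ultimately show ?thesis
    by (auto elim!: set_plus_elim)
qed

text \<open>No restriction to distinct vertices is needed: a proper subspace is never adjacent to
  itself, so the graph is simple.\<close>

lemma subspace_sum_graph_simple:
  assumes "vector_space scale"
  shows "loopfree_digraph (subspace_sum_graph scale)"
    and "nomulti_digraph (subspace_sum_graph scale)"
    and "sym_digraph (subspace_sum_graph scale)"
proof -
  show "loopfree_digraph (subspace_sum_graph scale)"
    by unfold_locales (auto simp: subspace_sum_graph_def Let_def subspace_plus_self[OF assms])
  show "nomulti_digraph (subspace_sum_graph scale)"
    by unfold_locales (auto simp: subspace_sum_graph_def Let_def arc_to_ends_def)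
  show "sym_digraph (subspace_sum_graph scale)"
    by unfold_locales
      (auto simp: subspace_sum_graph_def Let_def symmetric_def sym_def add.commute)
qed

end

theory Submission
  imports Defs
begin

text \<open>
  The bound \<open>2\<close> comes from linear functionals.  Given two vertices, pick nonzero vectors
  \<open>w\<^sub>1 \<in> W\<^sub>1\<close> and \<open>w\<^sub>2 \<in> W\<^sub>2\<close>.  Some linear functional \<open>f\<close> vanishes at neither
  (\<open>functional_nonzero_at_two\<close>), so its kernel \<open>H\<close> is a hyperplane that contains neither \<open>W\<^sub>1\<close>
  nor \<open>W\<^sub>2\<close>.  A hyperplane together with anything outside it spans the space
  (\<open>kernel_plus_subspace\<close>), hence \<open>H\<close> is adjacent to both.  Any two vertices thus have a
  common neighbour, which gives connectedness and all distances at most \<open>2\<close>.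

  The distance \<open>2\<close> is attained once the dimension is at least \<open>3\<close>: a line inside a plane is a
  pair of distinct vertices whose sum is only the plane.  (In dimension \<open>2\<close> all vertices
  are lines, and the graph is complete.)
\<close>

section \<open>Graphs in which any two vertices have a common neighbour\<close>

text \<open>A path of length \<open>0\<close> needs equal ends, and the single arc of a path of length \<open>1\<close> joins
  its ends.\<close>

lemma graph_dist_ge_2:
  assumes "wf_digraph G" and "u \<noteq> v" and "\<not> u \<rightarrow>\<^bsub>G\<^esub> v"
  shows "2 \<le> graph_dist G u v"
proof -
  interpret wf_digraph G by fact
  have "2 \<le> enat (length p)" if "apath u p v" for p
  proof -
    have "cas u p v" "set p \<subseteq> arcs G"
      using that by (auto simp: apath_def awalk_def)
    then have "p \<noteq> []" "tl p \<noteq> []"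
      using assms(2,3) by (cases p; cases "tl p"; auto dest: in_arcs_imp_in_arcs_ends)+
    then have "2 \<le> length p"
      by (cases p; cases "tl p") auto
    then show ?thesis
      by (metis enat_ord_simps(1) numeral_eq_enat)
  qed
  then show ?thesis
    unfolding graph_dist_def by (intro INF_greatest) simp
qed

text \<open>Without loops a common neighbour differs from both vertices, so the walk through it is a
  path unless it returns to its start.\<close>

lemma graph_dist_le_2:
  assumes "loopfree_digraph G" and "u \<rightarrow>\<^bsub>G\<^esub> w" and "w \<rightarrow>\<^bsub>G\<^esub> v"
  shows "graph_dist G u v \<le> 2"
proof -
  interpret loopfree_digraph G by fact
  obtain e1 e2 where e: "e1 \<in> arcs G" "tail G e1 = u" "head G e1 = w"
      "e2 \<in> arcs G" "tail G e2 = w" "head G e2 = v"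
    using assms(2,3) by (auto simp: arcs_ends_def arc_to_ends_def)
  have u: "u \<in> verts G" using e tail_in_verts by blast
  have "\<exists>p. apath u p v \<and> length p \<le> 2"
  proof (cases "u = v")
    case True
    then show ?thesis using u by (auto intro!: exI[of _ "[]"] simp: apath_Nil_iff)
  next
    case False
    have "u \<noteq> w" "w \<noteq> v" using e no_loops by metis+
    then have "apath u [e1, e2] v"
      using False e u by (auto simp: apath_def awalk_def)
    then show ?thesis by (intro exI[of _ "[e1, e2]"]) simp
  qed
  then obtain p where p: "apath u p v" "length p \<le> 2" by blast
  have "graph_dist G u v \<le> enat (length p)"
    unfolding graph_dist_def using p(1) by (intro INF_lower) simp
  also have "\<dots> \<le> 2"
    using p(2) by (metis enat_ord_simps(1) numeral_eq_enat)
  finally show ?thesis .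
qed

lemma connected_diameter_2I:
  assumes "loopfree_digraph G"
    and common: "\<And>u v. u \<in> verts G \<Longrightarrow> v \<in> verts G \<Longrightarrow> \<exists>w. u \<rightarrow>\<^bsub>G\<^esub> w \<and> w \<rightarrow>\<^bsub>G\<^esub> v"
    and ab: "a \<in> verts G" "b \<in> verts G" "a \<noteq> b" "\<not> a \<rightarrow>\<^bsub>G\<^esub> b"
  shows "Digraph_Component.connected G \<and> diameter G = 2"
proof
  interpret loopfree_digraph G by fact
  have "u \<rightarrow>\<^sup>*\<^bsub>G\<^esub> v" if "u \<in> verts G" "v \<in> verts G" for u v
    using common[OF that] by (meson reachable_adj_trans reachable_adjI)
  then have "u \<rightarrow>\<^sup>*\<^bsub>mk_symmetric G\<^esub> v" if "u \<in> verts G" "v \<in> verts G" for u v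
    using that by (blast intro: reachable_mk_symmetricI)
  then show "Digraph_Component.connected G"
    using ab(1) by (auto simp: connected_def strongly_connected_def)
  define D where "D = {graph_dist G u v | u v. u \<in> verts G \<and> v \<in> verts G}"
  have le: "d \<le> 2" if "d \<in> D" for d
    using that common graph_dist_le_2[OF assms(1)] unfolding D_def by blast
  have "graph_dist G a b \<in> D"
    using ab unfolding D_def by blast
  then have mem: "2 \<in> D"
    using le graph_dist_ge_2[OF wf_digraph_axioms ab(3,4)] by (metis order_antisym)
  have "(GREATEST m. m \<in> D) = 2"
    using mem le by (rule Greatest_equality)
  then show "diameter G = 2"
    using mem le unfolding diameter_def D_def[symmetric] Let_def by auto
qed

section \<open>Hyperplanes as kernels of linear functionals\<close>

context vector_space
begin

text \<open>Prescribing the value \<open>1\<close> at both vectors works if they are independent.  Otherwise one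
  is a nonzero multiple of the other, and a functional nonzero at one is nonzero at both.\<close>

lemma functional_nonzero_at_two:
  assumes "x \<noteq> 0" and "y \<noteq> 0"
  shows "\<exists>f. Vector_Spaces.linear scale (*) f \<and> f x \<noteq> 0 \<and> f y \<noteq> 0"
proof -
  interpret K: vector_space "(*) :: 'a \<Rightarrow> 'a \<Rightarrow> 'a"
    by unfold_locales (simp_all add: algebra_simps)
  interpret P: vector_space_pair scale "(*) :: 'a \<Rightarrow> 'a \<Rightarrow> 'a" ..
  show ?thesis
  proof (cases "y \<in> span {x}")
    case True
    then obtain c where c: "y = scale c x"
      by (auto simp: span_singleton)
    obtain f where f: "Vector_Spaces.linear scale (*) f" "f x = 1"
      using P.linear_independent_extend[of "{x}" "\<lambda>_. 1"] assms(1) by auto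
    have "f y = c"
      using f c P.linear_scale[OF f(1)] by simp
    moreover have "c \<noteq> 0"
      using c assms(2) by auto
    ultimately show ?thesis
      using f by auto
  next
    case False
    then have "independent {y, x}"
      using assms(1) by (intro independent_insertI) (auto simp: independent_empty)
    then obtain f where "Vector_Spaces.linear scale (*) f" "f x = 1" "f y = 1"
      using P.linear_independent_extend[of "{y, x}" "\<lambda>_. 1"] by auto
    then show ?thesis by auto
  qed
qed

text \<open>Subtracting from \<open>v\<close> the multiple of \<open>w\<close> at which \<open>f\<close> takes the same value leaves an
  element of the kernel.\<close>

lemma kernel_plus_subspace:
  assumes f: "Vector_Spaces.linear scale (*) f"
    and W: "subspace W" "w \<in> W" "f w \<noteq> 0"
  shows "W + {x. f x = 0} = UNIV"
proof -
  interpret f: Vector_Spaces.linear scale "(*)" f by fact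
  have "v \<in> W + {x. f x = 0}" for v
  proof -
    define t where "t = scale (f v / f w) w"
    have "t \<in> W"
      unfolding t_def using W by (simp add: subspace_scale)
    moreover have "f (v - t) = 0"
      unfolding t_def using W(3) by (simp add: f.diff f.scale)
    ultimately have "t + (v - t) \<in> W + {x. f x = 0}"
      by (intro set_plus_intro) auto
    then show ?thesis by simp
  qed
  then show ?thesis by blast
qed

lemma ex_common_complementary_subspace:
  assumes W: "subspace W1" "W1 \<noteq> {0}" "subspace W2" "W2 \<noteq> {0}"
  shows "\<exists>H. subspace H \<and> H \<noteq> UNIV \<and> W1 + H = UNIV \<and> W2 + H = UNIV"
proof -
  have "\<exists>w\<in>W. w \<noteq> 0" if "subspace W" "W \<noteq> {0}" for W
    using that subspace_0 by blast
  then obtain w1 w2 where w: "w1 \<in> W1" "w1 \<noteq> 0" "w2 \<in> W2" "w2 \<noteq> 0"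
    using W by metis
  then obtain f where f: "Vector_Spaces.linear scale (*) f" "f w1 \<noteq> 0" "f w2 \<noteq> 0"
    using functional_nonzero_at_two by blast
  interpret f: Vector_Spaces.linear scale "(*)" f by fact
  show ?thesis
    using f w W kernel_plus_subspace[OF f(1)] f.subspace_kernel
    by (intro exI[of _ "{x. f x = 0}"]) auto
qed

end

section \<open>The subspace sum graph\<close>

lemma verts_subspace_sum_graph:
  "verts (subspace_sum_graph scale) = {W. module.subspace scale W \<and> W \<noteq> {0} \<and> W \<noteq> UNIV}"
  by (simp add: subspace_sum_graph_def Let_def)

lemma adjacent_subspace_sum_graph_iff:
  "W1 \<rightarrow>\<^bsub>subspace_sum_graph scale\<^esub> W2 \<longleftrightarrow>
    W1 \<in> verts (subspace_sum_graph scale) \<and> W2 \<in> verts (subspace_sum_graph scale) \<and>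
    W1 + W2 = UNIV"
  by (auto simp: subspace_sum_graph_def Let_def)

lemma subspace_sum_graph_common_neighbour:
  fixes scale :: "'f::field \<Rightarrow> 'v::ab_group_add \<Rightarrow> 'v"
  assumes "vector_space scale"
    and W: "W1 \<in> verts (subspace_sum_graph scale)" "W2 \<in> verts (subspace_sum_graph scale)"
  shows "\<exists>H. W1 \<rightarrow>\<^bsub>subspace_sum_graph scale\<^esub> H \<and> H \<rightarrow>\<^bsub>subspace_sum_graph scale\<^esub> W2"
proof -
  interpret vector_space scale by fact
  obtain H where H: "subspace H" "H \<noteq> UNIV" "W1 + H = UNIV" "W2 + H = UNIV"
    using W ex_common_complementary_subspace[of W1 W2] by (auto simp: verts_subspace_sum_graph)
  \<comment> \<open>The zero subspace adds nothing to the proper subspace \<open>W1\<close>.\<close>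
  have "H \<noteq> {0}"
    using H(3) W(1) by (auto simp: verts_subspace_sum_graph set_plus_def)
  then show ?thesis
    using H W by (auto simp: adjacent_subspace_sum_graph_iff verts_subspace_sum_graph add.commute)
qed

text \<open>The witnesses are a line and a plane through it: their sum is the plane, which is
  proper because the dimension is at least \<open>3\<close>.\<close>

lemma subspace_sum_graph_nonadjacent:
  fixes scale :: "'f::field \<Rightarrow> 'v::ab_group_add \<Rightarrow> 'v"
  assumes "finite_dimensional_vector_space scale Basis"
    and dim: "vector_space.dim scale (UNIV :: 'v set) \<ge> 3"
  shows "\<exists>L P. L \<in> verts (subspace_sum_graph scale) \<and> P \<in> verts (subspace_sum_graph scale) \<and>
    L \<noteq> P \<and> \<not> L \<rightarrow>\<^bsub>subspace_sum_graph scale\<^esub> P"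
proof -
  interpret finite_dimensional_vector_space scale Basis by fact
  obtain B where B: "B \<subseteq> Basis" "card B = 2"
    using dim obtain_subset_with_card_n[of 2 Basis] by auto
  then obtain x y where xy: "B = {x, y}" "x \<noteq> y"
    by (auto simp: card_2_iff)
  have ind: "independent {x, y}" "independent {x}"
    using B(1) xy(1) by (auto intro!: independent_mono[OF independent_Basis] simp del: dependent_single)
  define L P where "L = span {x}" and "P = span {x, y}"
  have dims: "dim L = 1" "dim P = 2"
    using ind xy(2) by (simp_all add: L_def P_def dim_eq_card_independent)
  have sub: "subspace L" "subspace P" "L \<subseteq> P"
    by (auto simp: L_def P_def intro!: span_mono)
  have proper: "P \<noteq> UNIV" using dims dim by auto
  have "L + P \<subseteq> P"
    using sub by (auto elim!: set_plus_elim intro: subspace_add)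
  moreover have "L \<noteq> P" "L \<noteq> UNIV" using dims dim by auto
  moreover have "x \<noteq> 0" "x \<in> L" "x \<in> P"
    using ind(2) by (auto simp: L_def P_def intro: span_base)
  ultimately show ?thesis
    using sub proper
    by (intro exI[of _ L] exI[of _ P])
      (auto simp: adjacent_subspace_sum_graph_iff verts_subspace_sum_graph)
qed

theorem theorem3p2:
  fixes scale :: "'f::field \<Rightarrow> 'v::ab_group_add \<Rightarrow> 'v"
    and Basis :: "'v set"
  assumes "finite_dimensional_vector_space scale Basis"
    and "vector_space.dim scale (UNIV :: 'v set) \<ge> 3"
  shows "Digraph_Component.connected (subspace_sum_graph scale)
    \<and> diameter (subspace_sum_graph scale) = 2"
proof -
  have V: "vector_space scale"
    using assms(1) by (simp add: finite_dimensional_vector_space_def)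
  show ?thesis
    using subspace_sum_graph_nonadjacent[OF assms]
      connected_diameter_2I[OF subspace_sum_graph_simple(1)[OF V]
        subspace_sum_graph_common_neighbour[OF V]]
    by blast
qed

end
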